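(* Let $n\ge 2$ and let $(\mathfrak{L},[\cdot,\ldots,\cdot])$ be a complex nilpotent $n$-Lie algebra of finite dimension $k$, with $n<k$. Then $\mathfrak{L}$ admits a non-trivial transposed Poisson $n$-Lie structure, i.e. there exists a bilinear operation $\cdot$ on $\mathfrak{L}$, not identically zero, such that $(\mathfrak{L},\cdot,[\cdot,\ldots,\cdot])$ is a transposed Poisson $n$-Lie algebra.
   Context: All algebras and vector spaces are over $\mathbb{C}$. An $n$-Lie algebra is a vector space $\mathfrak{L}$ with an anticommutative (i.e. alternating) $n$-linear operation $[\cdot,\ldots,\cdot]$ satisfying $$[[x_1,\ldots,x_n],y_2,\ldots,y_n]=\sum_{i=1}^n [x_1,\ldots,[x_i,y_2,\ldots,y_n],\ldots,x_n].$$ It is nilpotent if the series $\mathfrak{L}^1=\mathfrak{L}$, $\mathfrak{L}^{s+1}=[\mathfrak{L}^s,\mathfrak{L},\ldots,\mathfrak{L}]$ reaches $0$. A transposed Poisson $n$-Lie algebra is a triple $(\mathfrak{L},\cdot,[\cdot,\ldots,\cdot])$ where $(\mathfrak{L},\cdot)$ is a commutative associative algebra (not necessarily unital), $(\mathfrak{L},[\cdot,\ldots,\cdot])$ is an $n$-Lie algebra, and $$z\cdot[x_1,\ldots,x_n]=\frac1n\sum_{i=1}^n[x_1,\ldots,z\cdot x_i,\ldots,x_n]\quad\text{for all } z,x_1,\ldots,x_n\in\mathfrak{L}.$$ *)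

theory Defs
  imports Complex_Main
begin

text \<open>
  An \<open>n\<close>-ary operation is a function on lists that is only ever inspected on lists of length \<open>n\<close>;
  its values on other lists are irrelevant. The slot replacement
  \<open>[x\<^sub>1, \<dots>, v, \<dots>, x\<^sub>n]\<close> is the list update \<open>xs[i := v]\<close>, with slots counted from 0.
  The underlying vector space is the whole type.
\<close>

locale n_lie_algebra = vector_space scale
  for scale :: "complex \<Rightarrow> 'a::ab_group_add \<Rightarrow> 'a" +
  fixes n :: nat
    and bracket :: "'a list \<Rightarrow> 'a"
  assumes multilinear:
      "\<And>xs i. length xs = n \<Longrightarrow> i < n \<Longrightarrow>
        Vector_Spaces.linear scale scale (\<lambda>v. bracket (xs[i := v]))"
    and alternating:
      "\<And>xs i j. length xs = n \<Longrightarrow> i < j \<Longrightarrow> j < n \<Longrightarrow> xs ! i = xs ! j \<Longrightarrow> bracket xs = 0"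
    and fundamental_identity:
      "\<And>xs ys. length xs = n \<Longrightarrow> length ys = n - 1 \<Longrightarrow>
        bracket (bracket xs # ys) = (\<Sum>i<n. bracket (xs[i := bracket (xs ! i # ys)]))"
begin

text \<open>
  The index is shifted by one: \<open>lower_central s\<close> is \<open>\<LL>\<^sup>s\<^sup>+\<^sup>1\<close>. As usual, the bracket
  \<open>[\<LL>\<^sup>s, \<LL>, \<dots>, \<LL>]\<close> of subspaces is the linear span of the brackets of their elements.
\<close>

primrec lower_central :: "nat \<Rightarrow> 'a set" where
  "lower_central 0 = UNIV"
| "lower_central (Suc s) =
    span {bracket (x # ys) | x ys. x \<in> lower_central s \<and> length ys = n - 1}"

definition nilpotent :: bool where
  "nilpotent \<longleftrightarrow> (\<exists>s. lower_central s = {0})"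

end

locale comm_assoc_algebra = vector_space scale
  for scale :: "complex \<Rightarrow> 'a::ab_group_add \<Rightarrow> 'a" +
  fixes mult :: "'a \<Rightarrow> 'a \<Rightarrow> 'a"
  assumes linear_left: "\<And>y. Vector_Spaces.linear scale scale (\<lambda>x. mult x y)"
    and linear_right: "\<And>x. Vector_Spaces.linear scale scale (\<lambda>y. mult x y)"
    and mult_assoc: "\<And>x y z. mult (mult x y) z = mult x (mult y z)"
    and mult_comm: "\<And>x y. mult x y = mult y x"

locale transposed_poisson_n_lie_algebra =
  comm_assoc_algebra scale mult + n_lie_algebra scale n bracket
  for scale :: "complex \<Rightarrow> 'a::ab_group_add \<Rightarrow> 'a"
    and mult :: "'a \<Rightarrow> 'a \<Rightarrow> 'a"
    and n :: nat
    and bracket :: "'a list \<Rightarrow> 'a" +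
  assumes transposed_leibniz:
    "\<And>z xs. length xs = n \<Longrightarrow>
      mult z (bracket xs) = scale (1 / of_nat n) (\<Sum>i<n. bracket (xs[i := mult z (xs ! i)]))"

end

theory Submission
  imports Defs
begin

text \<open>
  Nilpotency yields a nonzero central element \<open>c\<close> (in the last nonzero term of the lower central
  series) and a nonzero linear functional \<open>f\<close> vanishing on the derived algebra. For the product
  \<open>x \<cdot> y = f(x) f(y) c\<close> both sides of the transposed Leibniz rule vanish.
\<close>

text \<open>A basis \<open>C\<close> of \<open>span S\<close> stays independent when
  \<open>v\<close> is added, so the values 0 on \<open>C\<close> and 1 at \<open>v\<close> extend to
  a linear functional.\<close>

lemma (in vector_space) exists_functional_vanishing_on_span:
  assumes "v \<notin> span S"
  shows "\<exists>f. Vector_Spaces.linear scale (*) f \<and> (\<forall>x\<in>span S. f x = 0) \<and> f v = 1"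
proof -
  interpret functional: vector_space_pair scale "(*) :: 'a \<Rightarrow> 'a \<Rightarrow> 'a"
    by unfold_locales (auto simp: algebra_simps)
  obtain C where C: "C \<subseteq> span S" "independent C" "span S \<subseteq> span C"
    using basis_exists by metis
  have "span C \<subseteq> span S"
    using C(1) by (simp add: span_minimal)
  then have v: "v \<notin> span C"
    using assms by blast
  then have "independent (insert v C)"
    using C(2) independent_insert span_base by metis
  then obtain f where f: "Vector_Spaces.linear scale (*) f"
      "\<forall>x\<in>insert v C. f x = (if x = v then 1 else 0)"
    using functional.linear_independent_extend[of "insert v C" "\<lambda>x. if x = v then 1 else 0"] by blast
  have "f x = 0" if "x \<in> span S" for x
  proof (rule functional.linear_eq_0_on_span[OF f(1)])
    show "x \<in> span C"
      using that C(3) by blast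
    show "f y = 0" if "y \<in> C" for y
      using that f(2) v span_base by (metis insertCI)
  qed
  with f show ?thesis
    by auto
qed

context n_lie_algebra
begin

text \<open>Centrality is given for slot 0 only. Alternation in slots 0 and \<open>i\<close>,
  polarized, carries it over to slot \<open>i\<close>.\<close>

lemma bracket_update_eq_0:
  assumes c: "\<And>ys. length ys = n - 1 \<Longrightarrow> bracket (c # ys) = 0"
    and xs: "length xs = n" and i: "i < n"
  shows "bracket (xs[i := c]) = 0"
proof (cases "i = 0")
  case True
  then show ?thesis
    using xs i c[of "tl xs"] by (cases xs) auto
next
  case False
  define g where "g u v = bracket (xs[0 := u, i := v])" for u v
  have g_central: "g c v = 0" for v
    unfolding g_def using xs i False c[of "tl (xs[i := v])"]
    by (cases xs; cases i) auto
  have g_diag: "g u u = 0" for u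
    unfolding g_def using alternating[of "xs[0 := u, i := u]" 0 i] xs i False by simp
  have "Vector_Spaces.linear scale scale (\<lambda>v. g u v)" for u
    unfolding g_def using xs i by (intro multilinear) simp_all
  then have g_right: "g u (v + w) = g u v + g u w" for u v w
    by (simp add: Vector_Spaces.linear_iff)
  have "Vector_Spaces.linear scale scale (\<lambda>u. g u v)" for v
    unfolding g_def using multilinear[of "xs[i := v]" 0] xs i False
    by (simp add: list_update_swap)
  then have g_left: "g (u + v) w = g u w + g v w" for u v w
    by (simp add: Vector_Spaces.linear_iff)
  \<comment> \<open>The original entry of slot 0, so that \<open>g ?a c\<close> is the bracket in
    question.\<close>
  let ?a = "xs ! 0"
  \<comment> \<open>The other two terms of the expansion have \<open>c\<close> in slot 0 and vanish;
    the diagonal values are 0 by alternation.\<close>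
  have "g (?a + c) (?a + c) = g ?a ?a + g ?a c"
    by (simp only: g_right g_left g_central add_0_right)
  then have "g ?a c = 0"
    by (simp add: g_diag)
  then show ?thesis
    unfolding g_def by simp
qed

lemma lower_central_subspace: "subspace (lower_central s)"
  by (cases s) auto

text \<open>The element \<open>v\<close> excludes the zero space. The least \<open>s\<close> with
  zero term is then positive, and bracketing the preceding term with the whole algebra gives
  0.\<close>

lemma nilpotent_obtains_central:
  assumes nilpotent and "(v :: 'a) \<noteq> 0"
  obtains c where "c \<noteq> 0" and "\<And>ys. length ys = n - 1 \<Longrightarrow> bracket (c # ys) = 0"
proof -
  obtain s where s: "lower_central s = {0}" and min: "\<And>t. t < s \<Longrightarrow> lower_central t \<noteq> {0}"
    using assms(1) exists_least_iff[of "\<lambda>s. lower_central s = {0}"]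
    unfolding nilpotent_def by blast
  have "s \<noteq> 0"
    using s assms(2) by (metis UNIV_I lower_central.simps(1) singletonD)
  then obtain t where t: "s = Suc t"
    using not0_implies_Suc by blast
  obtain c where c: "c \<in> lower_central t" "c \<noteq> 0"
    using min[of t] t subspace_0[OF lower_central_subspace, of t] by auto
  have "bracket (c # ys) = 0" if "length ys = n - 1" for ys
  proof -
    have "bracket (c # ys) \<in> lower_central s"
      unfolding t lower_central.simps using that c(1) by (intro span_base) blast
    then show ?thesis
      using s by simp
  qed
  with c(2) show thesis
    by (rule that)
qed

text \<open>Each term of the series is determined by the one before it, so a perfect algebra would
  have a constant series that never reaches 0.\<close>

lemma nilpotent_derived_proper:
  assumes nilpotent and "(v :: 'a) \<noteq> 0"
  shows "lower_central 1 \<noteq> UNIV"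
proof
  assume *: "lower_central 1 = UNIV"
  have "lower_central s = UNIV" for s
    by (induction s) (use * in simp_all)
  then show False
    using assms unfolding nilpotent_def by auto
qed

text \<open>In the transposed Leibniz rule the left side contains the factor
  \<open>f (bracket xs)\<close>, and every summand on the right has a multiple of \<open>c\<close>
  in some slot.\<close>

lemma transposed_poisson_rank_one:
  assumes f: "Vector_Spaces.linear scale (*) f"
    and f_bracket: "\<And>xs. length xs = n \<Longrightarrow> f (bracket xs) = 0"
    and c: "\<And>ys. length ys = n - 1 \<Longrightarrow> bracket (c # ys) = 0"
  shows "transposed_poisson_n_lie_algebra scale (\<lambda>x y. scale (f x * f y) c) n bracket"
proof -
  have lin: "f (x + y) = f x + f y" "f (scale r x) = r * f x" for x y r
    using f unfolding Vector_Spaces.linear_iff by blast+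
  have update: "bracket (xs[i := scale r c]) = 0" if "length xs = n" "i < n" for xs i r
  proof -
    have "bracket (xs[i := scale r c]) = scale r (bracket (xs[i := c]))"
      using multilinear[OF that] unfolding Vector_Spaces.linear_iff by blast
    then show ?thesis
      using bracket_update_eq_0[OF c that] by simp
  qed
  let ?mult = "\<lambda>x y. scale (f x * f y) c"
  have commute: "?mult x y = ?mult y x" for x y
    by (simp add: mult.commute)
  have linear: "Vector_Spaces.linear scale scale (?mult x)" for x
    by (simp add: Vector_Spaces.linear_iff vector_space_axioms lin scale_left_distrib
        distrib_left mult.left_commute)
  show ?thesis
  proof (intro transposed_poisson_n_lie_algebra.intro comm_assoc_algebra.intro
      comm_assoc_algebra_axioms.intro transposed_poisson_n_lie_algebra_axioms.intro)
    show "vector_space scale" and "n_lie_algebra scale n bracket"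
      by unfold_locales
    show "Vector_Spaces.linear scale scale (?mult x)" for x
      by (rule linear)
    then show "Vector_Spaces.linear scale scale (\<lambda>x. ?mult x y)" for y
      by (simp only: commute[of _ y])
    \<comment> \<open>Both sides are \<open>f x * f y * f z * f c\<close> times \<open>c\<close>,
      whatever the value of \<open>f c\<close>.\<close>
    show "?mult (?mult x y) z = ?mult x (?mult y z)" for x y z
      by (simp add: lin ac_simps)
    show "?mult x y = ?mult y x" for x y
      by (rule commute)
    show "?mult z (bracket xs) = scale (1 / of_nat n) (\<Sum>i<n. bracket (xs[i := ?mult z (xs ! i)]))"
      if "length xs = n" for z xs
      using that by (simp add: f_bracket update)
  qed
qed

end

theorem theorem9:
  fixes scale :: "complex \<Rightarrow> 'a::ab_group_add \<Rightarrow> 'a"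
    and B :: "'a set"
    and bracket :: "'a list \<Rightarrow> 'a"
    and n k :: nat
  assumes "n \<ge> 2"
    and "n_lie_algebra scale n bracket"
    and "n_lie_algebra.nilpotent scale n bracket"
    and "finite_dimensional_vector_space scale B"
    and "vector_space.dim scale (UNIV :: 'a set) = k"
    and "n < k"
  shows "\<exists>mult :: 'a \<Rightarrow> 'a \<Rightarrow> 'a.
    (\<exists>x y. mult x y \<noteq> 0) \<and> transposed_poisson_n_lie_algebra scale mult n bracket"
proof -
  interpret n_lie_algebra scale n bracket
    by (rule assms(2))
  \<comment> \<open>The dimension is positive because \<open>n < k\<close>.\<close>
  have "\<exists>v :: 'a. v \<noteq> 0"
  proof (rule ccontr)
    assume "\<nexists>v :: 'a. v \<noteq> 0"
    then have "(UNIV :: 'a set) = {0}"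
      by auto
    then have "dim (UNIV :: 'a set) = 0"
      using dim_le_card[of UNIV "{}"] by simp
    then show False
      using assms(5,6) by simp
  qed
  then obtain v :: 'a where v: "v \<noteq> 0" ..
  obtain c where c: "c \<noteq> 0" "\<And>ys. length ys = n - 1 \<Longrightarrow> bracket (c # ys) = 0"
    using nilpotent_obtains_central[OF assms(3) v] by blast
  \<comment> \<open>The generators of \<open>lower_central 1\<close>, the condition
    \<open>x \<in> UNIV\<close> being dropped.\<close>
  let ?D = "{bracket (x # ys) | x ys. length ys = n - 1}"
  have "span ?D \<noteq> UNIV"
    using nilpotent_derived_proper[OF assms(3) v] by simp
  then obtain w where w: "w \<notin> span ?D"
    by (auto simp only: set_eq_iff UNIV_I)
  obtain f where f: "Vector_Spaces.linear scale (*) f" "\<forall>x\<in>span ?D. f x = 0" "f w = 1"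
    using exists_functional_vanishing_on_span[OF w] by (elim exE conjE)
  have f_bracket: "f (bracket xs) = 0" if "length xs = n" for xs
  proof (rule f(2)[rule_format])
    \<comment> \<open>Here \<open>n \<ge> 2\<close> guarantees that \<open>xs\<close> has a
      head.\<close>
    obtain x ys where "xs = x # ys" "length ys = n - 1"
      using \<open>length xs = n\<close> assms(1) by (cases xs) auto
    then have "bracket xs \<in> ?D"
      by blast
    then show "bracket xs \<in> span ?D"
      by (rule span_base)
  qed
  \<comment> \<open>Since \<open>f w = 1\<close>, the square of \<open>w\<close> under the new
    product is \<open>c\<close> itself.\<close>
  have "scale (f w * f w) c \<noteq> 0"
    using c(1) f(3) by simp
  then have "\<exists>x y. scale (f x * f y) c \<noteq> 0"
    by (intro exI)
  with transposed_poisson_rank_one[OF f(1) f_bracket c(2)] show ?thesis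
    by (intro exI[of _ "\<lambda>x y. scale (f x * f y) c"] conjI)
qed

end
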